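(* Any $2$-integral probability group with two elements is isomorphic to $A(\Bbbk\mathbb{Z}_2)$.
   Context: $\Bbbk$ is an algebraically closed field of characteristic zero. A probability group is a set $A$ with a map $(a,b,c)\mapsto p(a\cdot b=c)$ from $A\times A\times A$ to $\mathbb{R}_{\ge0}$ (the probability map) such that: (1) for all $a,b$, $p(a\cdot b=c)=0$ for all but finitely many $c$, and $\sum_{c}p(a\cdot b=c)=1$; (2) for all $a,b,c,d$, $\sum_{x}p(a\cdot b=x)p(x\cdot c=d)=\sum_{y}p(a\cdot y=d)p(b\cdot c=y)$; (3) there is $1\in A$ with $p(1\cdot a=a)=1=p(a\cdot1=a)$ for all $a$; (4) for each $a$ there is a unique $a^{-1}\in A$ with $p(a\cdot a^{-1}=1)>0$; (5) $p(a\cdot b=c)=p(b^{-1}\cdot a^{-1}=c^{-1})$ for all $a,b,c$; (6) $p(a\cdot a^{-1}=1)=p(a^{-1}\cdot a=1)$ for all $a$. The size of $a$ is $s(a)=1/p(a\cdot a^{-1}=1)$. For a positive integer $r$, $A$ is $r$-integral if $s(a)^{1/r}$ is an integer for all $a\in A$, and $p(a\cdot b=c)\,s(a)^{1/r}s(b)^{1/r}/s(c)^{1/r}$ is a non-negative integer for all $a,b,c\in A$. An isomorphism of probability groups is a bijection preserving the probability maps. For a finite group $G$ with irreducible $\Bbbk$-characters $\chi_1,\dots,\chi_m$ and $\chi_i\chi_j=\sum_kN_{ij}^k\chi_k$, $A(\Bbbk G)=\{\chi_1,\dots,\chi_m\}$ is the probability group with $p(\chi_i\cdot\chi_j=\chi_k)=\frac{N_{ij}^k\chi_k(1)}{\chi_i(1)\chi_j(1)}$.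 *)

theory Defs
  imports
    Complex_Main
    "HOL-Library.FuncSet"
    "HOL-Algebra.Elementary_Groups"
    "Jordan_Normal_Form.VS_Connect"
begin

section \<open>Probability groups\<close>

definition is_pg_one :: "'a set \<Rightarrow> ('a \<Rightarrow> 'a \<Rightarrow> 'a \<Rightarrow> real) \<Rightarrow> 'a \<Rightarrow> bool" where
  "is_pg_one A p e \<longleftrightarrow> e \<in> A \<and> (\<forall>a\<in>A. p e a a = 1 \<and> p a e a = 1)"

text \<open>In a probability group such an element is unique: if \<open>e\<close> and \<open>e'\<close> are two of them, then
  \<open>p e e' e = 1 = p e e' e'\<close>, and the probabilities \<open>p e e' c\<close> sum to 1.\<close>

definition pg_one :: "'a set \<Rightarrow> ('a \<Rightarrow> 'a \<Rightarrow> 'a \<Rightarrow> real) \<Rightarrow> 'a" where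
  "pg_one A p = (THE e. is_pg_one A p e)"

definition pg_inv :: "'a set \<Rightarrow> ('a \<Rightarrow> 'a \<Rightarrow> 'a \<Rightarrow> real) \<Rightarrow> 'a \<Rightarrow> 'a" where
  "pg_inv A p a = (THE b. b \<in> A \<and> p a b (pg_one A p) > 0)"

text \<open>\<open>p a b c\<close> is the probability that \<open>a \<cdot> b = c\<close>; only its values on the carrier \<open>A\<close> matter.
  As \<open>A\<close> may be infinite, sums range over the finite support of one of the factors.\<close>

locale probability_group =
  fixes A :: "'a set" and p :: "'a \<Rightarrow> 'a \<Rightarrow> 'a \<Rightarrow> real"
  assumes nonneg: "\<lbrakk>a \<in> A; b \<in> A; c \<in> A\<rbrakk> \<Longrightarrow> p a b c \<ge> 0"
    and finite_support: "\<lbrakk>a \<in> A; b \<in> A\<rbrakk> \<Longrightarrow> finite {c \<in> A. p a b c \<noteq> 0}"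
    and sum_one: "\<lbrakk>a \<in> A; b \<in> A\<rbrakk> \<Longrightarrow> (\<Sum>c\<in>{c \<in> A. p a b c \<noteq> 0}. p a b c) = 1"
    and assoc: "\<lbrakk>a \<in> A; b \<in> A; c \<in> A; d \<in> A\<rbrakk> \<Longrightarrow>
      (\<Sum>x\<in>{x \<in> A. p a b x \<noteq> 0}. p a b x * p x c d) =
      (\<Sum>y\<in>{y \<in> A. p b c y \<noteq> 0}. p a y d * p b c y)"
    and ex_one: "\<exists>e. is_pg_one A p e"
    and ex1_inv: "a \<in> A \<Longrightarrow> \<exists>!b. b \<in> A \<and> p a b (pg_one A p) > 0"
    and inv_mult: "\<lbrakk>a \<in> A; b \<in> A; c \<in> A\<rbrakk> \<Longrightarrow>
      p a b c = p (pg_inv A p b) (pg_inv A p a) (pg_inv A p c)"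
    and inv_comm: "a \<in> A \<Longrightarrow> p a (pg_inv A p a) (pg_one A p) = p (pg_inv A p a) a (pg_one A p)"

definition pg_size :: "'a set \<Rightarrow> ('a \<Rightarrow> 'a \<Rightarrow> 'a \<Rightarrow> real) \<Rightarrow> 'a \<Rightarrow> real" where
  "pg_size A p a = 1 / p a (pg_inv A p a) (pg_one A p)"

definition pg_integral :: "nat \<Rightarrow> 'a set \<Rightarrow> ('a \<Rightarrow> 'a \<Rightarrow> 'a \<Rightarrow> real) \<Rightarrow> bool" where
  "pg_integral r A p \<longleftrightarrow> r > 0 \<and>
     (\<forall>a\<in>A. root r (pg_size A p a) \<in> \<int>) \<and>
     (\<forall>a\<in>A. \<forall>b\<in>A. \<forall>c\<in>A.
        p a b c * root r (pg_size A p a) * root r (pg_size A p b) / root r (pg_size A p c) \<in> \<nat>)"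

definition pg_isomorphic ::
    "'a set \<Rightarrow> ('a \<Rightarrow> 'a \<Rightarrow> 'a \<Rightarrow> real) \<Rightarrow> 'b set \<Rightarrow> ('b \<Rightarrow> 'b \<Rightarrow> 'b \<Rightarrow> real) \<Rightarrow> bool" where
  "pg_isomorphic A p B q \<longleftrightarrow>
     (\<exists>f. bij_betw f A B \<and> (\<forall>a\<in>A. \<forall>b\<in>A. \<forall>c\<in>A. q (f a) (f b) (f c) = p a b c))"


section \<open>The probability group of irreducible characters of a finite group\<close>

text \<open>The unit group of \<open>ring_mat TYPE('k) n ()\<close> is the general linear group of degree \<open>n\<close>.\<close>

definition matrix_rep :: "('g, 'm) monoid_scheme \<Rightarrow> nat \<Rightarrow> ('g \<Rightarrow> 'k::field mat) \<Rightarrow> bool" where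
  "matrix_rep G n \<rho> \<longleftrightarrow> \<rho> \<in> hom G (units_of (ring_mat TYPE('k) n ()))"

definition irreducible_rep :: "('g, 'm) monoid_scheme \<Rightarrow> nat \<Rightarrow> ('g \<Rightarrow> 'k::field mat) \<Rightarrow> bool" where
  "irreducible_rep G n \<rho> \<longleftrightarrow> matrix_rep G n \<rho> \<and> n > 0 \<and>
     (\<forall>W. VectorSpace.subspace class_ring W (module_vec TYPE('k) n) \<longrightarrow>
        (\<forall>g\<in>carrier G. \<forall>w\<in>W. \<rho> g *\<^sub>v w \<in> W) \<longrightarrow>
        W = {0\<^sub>v n} \<or> W = carrier_vec n)"

text \<open>Characters are \<open>undefined\<close> outside the carrier, so that equality of characters is equality
  of functions on \<open>G\<close>.\<close>

definition rep_character :: "('g, 'm) monoid_scheme \<Rightarrow> nat \<Rightarrow> ('g \<Rightarrow> 'k::field mat) \<Rightarrow> 'g \<Rightarrow> 'k" where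
  "rep_character G n \<rho> = (\<lambda>g\<in>carrier G. \<Sum>i<n. \<rho> g $$ (i, i))"

definition irr_chars :: "('g, 'm) monoid_scheme \<Rightarrow> ('g \<Rightarrow> 'k::field) set" where
  "irr_chars G = {rep_character G n \<rho> | n \<rho>. irreducible_rep G n \<rho>}"

text \<open>\<open>\<chi> 1\<close> is an element of the field \<open>'k\<close>; in characteristic zero it determines a natural number.\<close>

definition char_degree :: "('g, 'm) monoid_scheme \<Rightarrow> ('g \<Rightarrow> 'k::field_char_0) \<Rightarrow> nat" where
  "char_degree G \<chi> = (THE n. of_nat n = \<chi> \<one>\<^bsub>G\<^esub>)"

text \<open>The coefficients in the decomposition of \<open>\<chi> \<psi>\<close> as a sum of irreducible characters; they are
  unique because the irreducible characters are linearly independent.\<close>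

definition char_coeff ::
    "('g, 'm) monoid_scheme \<Rightarrow> ('g \<Rightarrow> 'k::field_char_0) \<Rightarrow> ('g \<Rightarrow> 'k) \<Rightarrow> ('g \<Rightarrow> 'k) \<Rightarrow> nat" where
  "char_coeff G \<chi> \<psi> =
     (THE N. (\<forall>g\<in>carrier G. \<chi> g * \<psi> g = (\<Sum>\<phi>\<in>irr_chars G. of_nat (N \<phi>) * \<phi> g)) \<and>
             (\<forall>\<phi>. \<phi> \<notin> irr_chars G \<longrightarrow> N \<phi> = 0))"

definition char_prob ::
    "('g, 'm) monoid_scheme \<Rightarrow> ('g \<Rightarrow> 'k::field_char_0) \<Rightarrow> ('g \<Rightarrow> 'k) \<Rightarrow> ('g \<Rightarrow> 'k) \<Rightarrow> real" where
  "char_prob G \<chi> \<psi> \<phi> =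
     real (char_coeff G \<chi> \<psi> \<phi>) * real (char_degree G \<phi>) /
     (real (char_degree G \<chi>) * real (char_degree G \<psi>))"

end

theory Submission
  imports Defs
begin

text \<open>
  Let \<open>A = {1, a}\<close>. Since \<open>p(a \<cdot> 1 = 1) = 0\<close>, the element \<open>a\<close> is its own inverse, so
  \<open>p(a \<cdot> a = 1) = 1 / d\<^sup>2\<close> with \<open>d = \<surd>s(a)\<close>, and \<open>p(a \<cdot> a = a) = 1 - 1 / d\<^sup>2\<close>.
  Being \<open>2\<close>-integral forces \<open>d\<close> and \<open>(1 - 1 / d\<^sup>2) * d * d / d = d - 1 / d\<close> to be integers.
  Hence \<open>1 / d\<close> is an integer, \<open>d = 1\<close>, and \<open>a \<cdot> a = 1\<close> with certainty: the probability map of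
  \<open>A\<close> is the multiplication table of the group of order two (\<open>two_element_pg_table\<close>).

  The irreducible characters of \<open>\<int>\<^sub>2\<close> have the same table. The generator acts by
  some \<open>T\<close> with \<open>T\<^sup>2 = 1\<close>, and such a \<open>T\<close> has an eigenvector: \<open>T\<close> fixes \<open>v + T v\<close>, and if this
  vector vanishes, then \<open>T v = -v\<close>. The line through it is invariant, so irreducible representations are one-dimensional
  (\<open>irreducible_rep_eigenvector\<close>) and given by a sign (\<open>irr_chars_Z2\<close>). The two resulting characters
  multiply like their signs, so that each product is a single irreducible character, which is then
  the outcome with probability one (\<open>char_prob_Z2\<close>).
\<close>

section \<open>Probability groups with two elements\<close>

context probability_group
begin

lemma is_pg_one_pg_one: "is_pg_one A p (pg_one A p)"
proof -
  have "e = e'" if e: "is_pg_one A p e" and e': "is_pg_one A p e'" for e e'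
  proof (rule ccontr)
    assume "e \<noteq> e'"
    have in_A: "e \<in> A" "e' \<in> A" using e e' by (auto simp: is_pg_one_def)
    have v: "p e e' e' = 1" "p e e' e = 1" using e e' in_A by (auto simp: is_pg_one_def)
    have "sum (p e e') {e, e'} \<le> (\<Sum>c\<in>{c \<in> A. p e e' c \<noteq> 0}. p e e' c)"
      using in_A v nonneg finite_support by (intro sum_mono2) auto
    then show False using sum_one[OF in_A] \<open>e \<noteq> e'\<close> v by simp
  qed
  then have "\<exists>!e. is_pg_one A p e" using ex_one by blast
  then show ?thesis unfolding pg_one_def by (rule theI')
qed

lemma pg_inv_props:
  assumes "a \<in> A"
  shows "pg_inv A p a \<in> A" and "p a (pg_inv A p a) (pg_one A p) > 0"
  using theI'[OF ex1_inv[OF assms]] unfolding pg_inv_def by auto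

lemma sum_one_finite:
  assumes "finite A" "a \<in> A" "b \<in> A"
  shows "(\<Sum>c\<in>A. p a b c) = 1"
proof -
  have "(\<Sum>c\<in>A. p a b c) = (\<Sum>c\<in>{c \<in> A. p a b c \<noteq> 0}. p a b c)"
    using assms by (intro sum.mono_neutral_right) auto
  then show ?thesis using sum_one[OF assms(2,3)] by simp
qed

end

text \<open>Both \<open>d\<close> and \<open>1 / d\<close> are positive integers, hence at least \<open>1\<close>.\<close>

lemma Ints_pos_diff_inverse_eq_one:
  fixes d :: real
  assumes "d \<in> \<int>" "d > 0" "d - 1 / d \<in> \<int>"
  shows "d = 1"
proof -
  have "d - (d - 1 / d) \<in> \<int>" using assms by (blast intro: Ints_diff)
  then have "1 / d \<in> \<int>" by simp
  then have "1 / d \<ge> 1" using assms(2) Ints_nonzero_abs_ge1[of "1 / d"] by auto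
  moreover have "d \<ge> 1" using assms Ints_nonzero_abs_ge1[of d] by auto
  ultimately show ?thesis by (simp add: field_simps)
qed

lemma two_element_pg_table:
  fixes A :: "'a set" and p :: "'a \<Rightarrow> 'a \<Rightarrow> 'a \<Rightarrow> real"
  assumes "probability_group A p" "card A = 2" "pg_integral 2 A p"
  obtains e a where "A = {e, a}" "e \<noteq> a"
    "\<And>x y z. \<lbrakk>x \<in> A; y \<in> A; z \<in> A\<rbrakk> \<Longrightarrow> p x y z = (if (z = e) = (x = y) then 1 else 0)"
proof -
  interpret probability_group A p by fact
  define e where "e = pg_one A p"
  have e: "e \<in> A" "\<And>x. x \<in> A \<Longrightarrow> p e x x = 1 \<and> p x e x = 1"
    using is_pg_one_pg_one by (auto simp: e_def is_pg_one_def)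
  from \<open>card A = 2\<close> e(1) obtain a where A: "A = {e, a}" and ea: "e \<noteq> a"
    by (auto simp: card_2_iff)
  have sum: "p x y e + p x y a = 1" if "x \<in> A" "y \<in> A" for x y
    using sum_one_finite[of x y] that A ea by auto
  have a: "a \<in> A" using A by simp
  have aee: "p a e e = 0" using sum[OF a e(1)] e(2)[OF a] by simp
  have "pg_inv A p a = a"
    using pg_inv_props[OF a] aee unfolding A e_def[symmetric, unfolded A] by auto
  then have size: "pg_size A p a = 1 / p a a e" and pos: "p a a e > 0"
    using pg_inv_props(2)[OF a] by (auto simp: pg_size_def e_def)
  define d where "d = root 2 (pg_size A p a)"
  have d0: "d > 0" using pos by (simp add: d_def size)
  have "d ^ 2 = 1 / p a a e" unfolding d_def size using pos by (subst real_root_pow_pos2) auto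
  then have q: "p a a e = 1 / d ^ 2" by simp
  have "d \<in> \<int>" using assms(3) a by (simp add: pg_integral_def d_def)
  moreover have "p a a a * d * d / d \<in> \<nat>"
    using assms(3) a unfolding pg_integral_def d_def by blast
  moreover have "p a a a * d * d / d = d - 1 / d"
  proof -
    have "p a a a = 1 - 1 / d ^ 2" using sum[OF a a] q by simp
    then show ?thesis using d0 by (simp add: field_simps power2_eq_square)
  qed
  ultimately have "d = 1" using d0 Nats_subset_Ints
    by (intro Ints_pos_diff_inverse_eq_one) auto
  then have "p a a e = 1" "p a a a = 0" using q sum[OF a a] by auto
  moreover have "p e e a = 0" "p e a e = 0"
    using sum[OF e(1) e(1)] sum[OF e(1) a] e(2)[OF e(1)] e(2)[OF a] by auto
  ultimately have "p x y z = (if (z = e) = (x = y) then 1 else 0)"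
    if "x \<in> A" "y \<in> A" "z \<in> A" for x y z
    using that ea aee e(2)[OF e(1)] e(2)[OF a] unfolding A by auto
  with A ea show ?thesis by (rule that)
qed

section \<open>Irreducible representations with a common eigenvector\<close>

lemma line_is_subspace:
  fixes w :: "'k::field vec"
  assumes "w \<in> carrier_vec n"
  shows "VectorSpace.subspace class_ring (range (\<lambda>c. c \<cdot>\<^sub>v w)) (module_vec TYPE('k) n)"
proof (rule subspace.intro[OF vec_vs], rule submodule.intro[OF vec_module])
  show "range (\<lambda>c. c \<cdot>\<^sub>v w) \<subseteq> carrier (module_vec TYPE('k) n)"
    using assms by (auto simp: module_vec_simps)
  show "v \<oplus>\<^bsub>module_vec TYPE('k) n\<^esub> u \<in> range (\<lambda>c. c \<cdot>\<^sub>v w)"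
    if "v \<in> range (\<lambda>c. c \<cdot>\<^sub>v w)" "u \<in> range (\<lambda>c. c \<cdot>\<^sub>v w)" for v u
    using that by (auto simp: module_vec_simps add_smult_distrib_vec[symmetric])
  have "0 \<cdot>\<^sub>v w = 0\<^sub>v n" using assms by auto
  then show "\<zero>\<^bsub>module_vec TYPE('k) n\<^esub> \<in> range (\<lambda>c. c \<cdot>\<^sub>v w)"
    by (simp add: module_vec_simps) (metis rangeI)
  show "c \<odot>\<^bsub>module_vec TYPE('k) n\<^esub> v \<in> range (\<lambda>c. c \<cdot>\<^sub>v w)"
    if "v \<in> range (\<lambda>c. c \<cdot>\<^sub>v w)" for c v
    using that by (auto simp: module_vec_simps smult_smult_assoc)
qed

lemma line_eq_carrier_vec_imp_dim_one:
  fixes w :: "'k::field vec"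
  assumes w: "w \<in> carrier_vec n" "w \<noteq> 0\<^sub>v n" and line: "range (\<lambda>c. c \<cdot>\<^sub>v w) = carrier_vec n"
  shows "n = 1"
proof -
  from w obtain i where i: "i < n" "w $ i \<noteq> 0" by (metis carrier_vecD eq_vecI index_zero_vec)
  have "j = i" if j: "j < n" for j
  proof (rule ccontr)
    assume "j \<noteq> i"
    \<comment> \<open>A multiple of \<open>w\<close> that vanishes at \<open>i\<close> is zero, and so cannot be a unit vector.\<close>
    have "unit_vec n j \<in> range (\<lambda>c. c \<cdot>\<^sub>v w)" unfolding line by simp
    then obtain c where c: "unit_vec n j = c \<cdot>\<^sub>v w" by auto
    have "unit_vec n j $ i = (0::'k)" using i j \<open>j \<noteq> i\<close> by simp
    then have "c = 0" using i w(1) by (simp add: c)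
    moreover have "(1::'k) = unit_vec n j $ j" using j by simp
    ultimately show False using w(1) j by (simp add: c)
  qed
  from this[of 0] this[of "n - 1"] i(1) show ?thesis by linarith
qed

text \<open>The line through a common eigenvector is a nonzero invariant subspace, hence the whole
  space.\<close>

lemma irreducible_rep_eigenvector:
  fixes \<rho> :: "'g \<Rightarrow> 'k::field mat"
  assumes irr: "irreducible_rep G n \<rho>" and w: "w \<in> carrier_vec n" "w \<noteq> 0\<^sub>v n"
    and eig: "\<And>g. g \<in> carrier G \<Longrightarrow> \<rho> g \<in> carrier_mat n n \<and> (\<exists>c. \<rho> g *\<^sub>v w = c \<cdot>\<^sub>v w)"
  shows "n = 1"
proof -
  let ?W = "range (\<lambda>c. c \<cdot>\<^sub>v w)"
  have "\<rho> g *\<^sub>v v \<in> ?W" if g: "g \<in> carrier G" and v: "v \<in> ?W" for g v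
  proof -
    from v obtain b where v: "v = b \<cdot>\<^sub>v w" by auto
    from eig[OF g] obtain c where c: "\<rho> g *\<^sub>v w = c \<cdot>\<^sub>v w" by auto
    have "\<rho> g *\<^sub>v v = b \<cdot>\<^sub>v (\<rho> g *\<^sub>v w)"
      using eig[OF g] w(1) by (auto simp: v intro: mult_mat_vec)
    then show ?thesis by (auto simp: c smult_smult_assoc)
  qed
  with irr line_is_subspace[OF w(1)] have "?W = {0\<^sub>v n} \<or> ?W = carrier_vec n"
    unfolding irreducible_rep_def by blast
  moreover have "w \<in> ?W" by (metis one_smult_vec rangeI)
  ultimately have "?W = carrier_vec n" using w(2) by blast
  then show ?thesis by (rule line_eq_carrier_vec_imp_dim_one[OF w])
qed

text \<open>For any \<open>v \<noteq> 0\<close>, either \<open>v + T v\<close> is a nonzero vector fixed by \<open>T\<close>, or \<open>T v = -v\<close>.\<close>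

lemma involution_has_eigenvector:
  fixes T :: "'k::field mat"
  assumes T: "T \<in> carrier_mat n n" and TT: "T * T = 1\<^sub>m n" and "n > 0"
  obtains w c where "w \<in> carrier_vec n" "w \<noteq> 0\<^sub>v n" "T *\<^sub>v w = c \<cdot>\<^sub>v w"
proof -
  define v :: "'k vec" where "v = unit_vec n 0"
  have v: "v \<in> carrier_vec n" "v \<noteq> 0\<^sub>v n"
    using \<open>n > 0\<close> by (auto simp: v_def unit_vec_nonzero)
  have Tv: "T *\<^sub>v v \<in> carrier_vec n" using T v by auto
  have TTv: "T *\<^sub>v (T *\<^sub>v v) = v"
    using assoc_mult_mat_vec[OF T T v(1)] TT v(1) by simp
  show thesis
  proof (cases "v + T *\<^sub>v v = 0\<^sub>v n")
    case True
    have "T *\<^sub>v v = (-1) \<cdot>\<^sub>v v"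
    proof (rule eq_vecI)
      fix i assume "i < dim_vec ((-1) \<cdot>\<^sub>v v)"
      then have i: "i < n" using v(1) by simp
      have "(v + T *\<^sub>v v) $ i = 0" using True i by simp
      moreover have "(v + T *\<^sub>v v) $ i = v $ i + (T *\<^sub>v v) $ i"
        using i Tv by (intro index_add_vec) (auto dest: carrier_vecD)
      ultimately show "(T *\<^sub>v v) $ i = ((-1) \<cdot>\<^sub>v v) $ i"
        using i v(1) by (simp add: eq_neg_iff_add_eq_0 add.commute)
    qed (use T v(1) in auto)
    with v show thesis by (rule that)
  next
    case False
    have "T *\<^sub>v (v + T *\<^sub>v v) = 1 \<cdot>\<^sub>v (v + T *\<^sub>v v)"
      using mult_add_distrib_mat_vec[OF T v(1) Tv] comm_add_vec[OF v(1) Tv] TTv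
      by simp
    then show thesis using False v(1) Tv by (intro that[of "v + T *\<^sub>v v"]) auto
  qed
qed

section \<open>The characters of the group of order two\<close>

abbreviation Z2 :: "int monoid" where
  "Z2 \<equiv> integer_mod_group 2"

lemma carrier_Z2: "carrier Z2 = {0, 1}"
  by (auto simp: carrier_integer_mod_group)

definition sign_char :: "'k \<Rightarrow> int \<Rightarrow> 'k::field" where
  "sign_char \<epsilon> = (\<lambda>g\<in>carrier Z2. if g = 0 then 1 else \<epsilon>)"

lemma sign_char_simps [simp]: "sign_char \<epsilon> 0 = 1" "sign_char \<epsilon> 1 = \<epsilon>"
  by (simp_all add: sign_char_def carrier_Z2)

lemma sign_char_inject [simp]: "sign_char \<epsilon> = sign_char \<delta> \<longleftrightarrow> \<epsilon> = \<delta>"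
  by (metis sign_char_simps(2))

lemma matrix_rep_Z2:
  fixes \<rho> :: "int \<Rightarrow> 'k::field mat"
  shows "matrix_rep Z2 n \<rho> \<longleftrightarrow>
    \<rho> 0 = 1\<^sub>m n \<and> \<rho> 1 \<in> carrier_mat n n \<and> \<rho> 1 * \<rho> 1 = 1\<^sub>m n" (is "?L \<longleftrightarrow> ?R")
proof -
  let ?M = "ring_mat TYPE('k) n ()"
  have mon: "Group.monoid ?M" using ring_mat by (rule ring.is_monoid)
  show ?thesis
  proof
    assume L: ?L
    then have hom: "\<rho> \<in> hom Z2 (units_of ?M)" by (simp add: matrix_rep_def)
    have one: "\<rho> 0 = 1\<^sub>m n"
      using hom_one[OF hom group_integer_mod_group monoid.units_group[OF mon]]
      by (simp add: units_of_one ring_mat_simps)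
    have "\<rho> 1 \<in> Units ?M"
      using hom_in_carrier[OF hom, of 1] by (simp add: carrier_Z2 units_of_carrier)
    then have "\<rho> 1 \<in> carrier_mat n n"
      using monoid.Units_closed[OF mon] by (simp add: ring_mat_simps)
    moreover have "\<rho> 1 * \<rho> 1 = 1\<^sub>m n"
      using hom_mult[OF hom, of 1 1] one by (simp add: carrier_Z2 units_of_mult ring_mat_simps)
    ultimately show ?R using one by simp
  next
    assume R: ?R
    have "\<rho> g \<in> Units ?M" if "g \<in> carrier Z2" for g
      using that R by (auto simp: Units_def carrier_Z2 ring_mat_simps)
    moreover have "\<rho> (g \<otimes>\<^bsub>Z2\<^esub> h) = \<rho> g * \<rho> h" if "g \<in> carrier Z2" "h \<in> carrier Z2" for g h
      using that R by (auto simp: carrier_Z2)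
    ultimately show ?L
      by (auto simp: matrix_rep_def hom_def units_of_carrier units_of_mult ring_mat_simps)
  qed
qed

lemma irreducible_rep_Z2_dim_one:
  fixes \<rho> :: "int \<Rightarrow> 'k::field mat"
  assumes irr: "irreducible_rep Z2 n \<rho>"
  shows "n = 1"
proof -
  from irr have "n > 0" and rep: "matrix_rep Z2 n \<rho>" by (auto simp: irreducible_rep_def)
  from rep have \<rho>: "\<rho> 0 = 1\<^sub>m n" "\<rho> 1 \<in> carrier_mat n n" "\<rho> 1 * \<rho> 1 = 1\<^sub>m n"
    by (auto simp: matrix_rep_Z2)
  obtain w c where w: "w \<in> carrier_vec n" "w \<noteq> 0\<^sub>v n" and c: "\<rho> 1 *\<^sub>v w = c \<cdot>\<^sub>v w"
    using involution_has_eigenvector[OF \<rho>(2,3) \<open>n > 0\<close>] by blast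
  have "\<rho> 0 *\<^sub>v w = 1 \<cdot>\<^sub>v w" using w \<rho>(1) by simp
  then have "\<exists>b. \<rho> g *\<^sub>v w = b \<cdot>\<^sub>v w" if "g \<in> carrier Z2" for g
    using that c unfolding carrier_Z2 by blast
  moreover have "\<rho> g \<in> carrier_mat n n" if "g \<in> carrier Z2" for g
    using that \<rho> by (auto simp: carrier_Z2)
  ultimately show ?thesis by (intro irreducible_rep_eigenvector[OF irr w]) blast
qed

lemma irreducible_rep_dim_one:
  fixes \<rho> :: "'g \<Rightarrow> 'k::field mat"
  assumes "matrix_rep G 1 \<rho>"
  shows "irreducible_rep G 1 \<rho>"
  unfolding irreducible_rep_def
proof (intro conjI allI impI assms)
  fix W :: "'k vec set"
  assume "VectorSpace.subspace class_ring W (module_vec TYPE('k) 1)"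
  then have "submodule class_ring W (module_vec TYPE('k) 1)" by (rule subspace.submod)
  then have sub: "W \<subseteq> carrier_vec 1" and zero: "0\<^sub>v 1 \<in> W"
    and smult: "\<And>c v. v \<in> W \<Longrightarrow> c \<cdot>\<^sub>v v \<in> W"
    unfolding submodule_def by (auto simp: module_vec_simps class_ring_simps)
  show "W = {0\<^sub>v 1} \<or> W = carrier_vec 1"
  proof (rule disjCI)
    assume "W \<noteq> carrier_vec 1"
    have "w = 0\<^sub>v 1" if w: "w \<in> W" for w
    proof (rule ccontr)
      assume "w \<noteq> 0\<^sub>v 1"
      have w1: "w \<in> carrier_vec 1" using w sub by blast
      with \<open>w \<noteq> 0\<^sub>v 1\<close> have "w $ 0 \<noteq> 0" by (auto intro!: eq_vecI)
      have "v \<in> W" if v: "v \<in> carrier_vec 1" for v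
      proof -
        have "v = (v $ 0 / w $ 0) \<cdot>\<^sub>v w"
          using v w1 \<open>w $ 0 \<noteq> 0\<close> by (intro eq_vecI) auto
        then show ?thesis using smult[OF w] by metis
      qed
      with sub \<open>W \<noteq> carrier_vec 1\<close> show False by blast
    qed
    with zero show "W = {0\<^sub>v 1}" by blast
  qed
qed simp

lemma irr_chars_Z2: "irr_chars Z2 = {sign_char 1, sign_char (-1 :: 'k::field)}"
proof (intro equalityI subsetI)
  fix \<chi> :: "int \<Rightarrow> 'k"
  assume "\<chi> \<in> irr_chars Z2"
  then obtain n and \<rho> :: "int \<Rightarrow> 'k mat"
    where \<chi>: "\<chi> = rep_character Z2 n \<rho>" and irr: "irreducible_rep Z2 n \<rho>"
    by (auto simp: irr_chars_def)
  have n: "n = 1" using irr by (rule irreducible_rep_Z2_dim_one)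
  from irr have "matrix_rep Z2 1 \<rho>" by (simp add: irreducible_rep_def n)
  then have \<rho>: "\<rho> 0 = 1\<^sub>m 1" "\<rho> 1 \<in> carrier_mat 1 1" "\<rho> 1 * \<rho> 1 = 1\<^sub>m 1"
    by (auto simp: matrix_rep_Z2)
  define \<epsilon> where "\<epsilon> = \<rho> 1 $$ (0, 0)"
  have "(\<rho> 1 * \<rho> 1) $$ (0, 0) = \<epsilon> * \<epsilon>"
    using \<rho>(2) by (auto simp: \<epsilon>_def times_mat_def scalar_prod_def)
  then have "\<epsilon> * \<epsilon> = 1" using \<rho>(3) by simp
  then have "\<epsilon> = 1 \<or> \<epsilon> = -1" by (simp add: square_eq_1_iff)
  moreover have "\<chi> = sign_char \<epsilon>"
    using \<rho>(1) by (auto simp: \<chi> n rep_character_def sign_char_def \<epsilon>_def carrier_Z2 fun_eq_iff)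
  ultimately show "\<chi> \<in> {sign_char 1, sign_char (-1)}" by auto
next
  fix \<chi> :: "int \<Rightarrow> 'k"
  assume "\<chi> \<in> {sign_char 1, sign_char (-1)}"
  then obtain \<epsilon> where \<chi>: "\<chi> = sign_char \<epsilon>" and \<epsilon>: "\<epsilon> * \<epsilon> = 1" by auto
  define \<rho> :: "int \<Rightarrow> 'k mat" where "\<rho> g = mat 1 1 (\<lambda>_. sign_char \<epsilon> g)" for g
  have "matrix_rep Z2 1 \<rho>"
    by (auto simp: matrix_rep_Z2 \<rho>_def scalar_prod_def \<epsilon> intro!: eq_matI)
  then have "irreducible_rep Z2 1 \<rho>" by (rule irreducible_rep_dim_one)
  moreover have "\<chi> = rep_character Z2 1 \<rho>"
    by (auto simp: \<chi> rep_character_def \<rho>_def sign_char_def)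
  ultimately show "\<chi> \<in> irr_chars Z2" by (auto simp: irr_chars_def)
qed

lemma char_degree_sign_char: "char_degree Z2 (sign_char \<epsilon> :: int \<Rightarrow> 'k::field_char_0) = 1"
  unfolding char_degree_def by (rule the_equality) auto

text \<open>The multiplicities are pinned down by the values at the two group elements, which give their
  sum and their difference.\<close>

lemma char_coeff_sign_char:
  fixes \<epsilon> \<delta> \<gamma> :: "'k::field_char_0"
  assumes "\<epsilon> \<in> {1, -1}" "\<delta> \<in> {1, -1}" "\<gamma> \<in> {1, -1}"
  shows "char_coeff Z2 (sign_char \<epsilon>) (sign_char \<delta>) (sign_char \<gamma>) = (if \<gamma> = \<epsilon> * \<delta> then 1 else 0)"
proof -
  let ?N0 = "\<lambda>\<phi>. if \<phi> = sign_char (\<epsilon> * \<delta>) then 1 else 0 :: nat"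
  have prod: "\<epsilon> * \<delta> = 1 \<or> \<epsilon> * \<delta> = -1" using assms by auto
  have neq: "(1::'k) \<noteq> -1" "(-1::'k) \<noteq> 1" by simp_all
  have "char_coeff Z2 (sign_char \<epsilon>) (sign_char \<delta>) = ?N0"
    unfolding char_coeff_def
  proof (rule the_equality)
    show "(\<forall>g\<in>carrier Z2. sign_char \<epsilon> g * sign_char \<delta> g
             = (\<Sum>\<phi>\<in>irr_chars Z2. of_nat (?N0 \<phi>) * \<phi> g)) \<and>
          (\<forall>\<phi>. \<phi> \<notin> irr_chars Z2 \<longrightarrow> ?N0 \<phi> = 0)"
      using prod neq by (auto simp: carrier_Z2 irr_chars_Z2)
  next
    fix N :: "(int \<Rightarrow> 'k) \<Rightarrow> nat"
    assume N: "(\<forall>g\<in>carrier Z2. sign_char \<epsilon> g * sign_char \<delta> g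
                  = (\<Sum>\<phi>\<in>irr_chars Z2. of_nat (N \<phi>) * \<phi> g)) \<and>
               (\<forall>\<phi>. \<phi> \<notin> irr_chars Z2 \<longrightarrow> N \<phi> = 0)"
    let ?a = "N (sign_char 1)" and ?b = "N (sign_char (-1))"
    have "(1::'k) = of_nat ?a + of_nat ?b"
      using N neq by (auto simp: carrier_Z2 irr_chars_Z2)
    then have "of_nat (?a + ?b) = (of_nat 1 :: 'k)" by simp
    then have s: "?a + ?b = 1" by (simp only: of_nat_eq_iff)
    have diff: "\<epsilon> * \<delta> = of_nat ?a - of_nat ?b"
      using N neq by (auto simp: carrier_Z2 irr_chars_Z2)
    from s consider "?a = 1" "?b = 0" | "?a = 0" "?b = 1" by linarith
    then have ab: "?a = ?N0 (sign_char 1)" "?b = ?N0 (sign_char (-1))"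
      using diff neq by (cases; simp)+
    show "N = ?N0"
    proof
      fix \<phi> show "N \<phi> = ?N0 \<phi>"
      proof (cases "\<phi> \<in> irr_chars Z2")
        case True
        then show ?thesis using ab unfolding irr_chars_Z2 by blast
      next
        case False
        then show ?thesis using N prod by (auto simp: irr_chars_Z2)
      qed
    qed
  qed
  then show ?thesis by simp
qed

lemma char_prob_Z2:
  fixes \<epsilon> \<delta> \<gamma> :: "'k::field_char_0"
  assumes "\<epsilon> \<in> {1, -1}" "\<delta> \<in> {1, -1}" "\<gamma> \<in> {1, -1}"
  shows "char_prob Z2 (sign_char \<epsilon>) (sign_char \<delta>) (sign_char \<gamma>) = (if \<gamma> = \<epsilon> * \<delta> then 1 else 0)"
  using assms by (simp add: char_prob_def char_degree_sign_char char_coeff_sign_char)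

section \<open>The isomorphism\<close>

theorem mainTheorem6:
  fixes A :: "'a set" and p :: "'a \<Rightarrow> 'a \<Rightarrow> 'a \<Rightarrow> real"
  assumes "probability_group A p"
    and "card A = 2"
    and "pg_integral 2 A p"
  shows "pg_isomorphic A p
           (irr_chars (integer_mod_group 2) :: (int \<Rightarrow> 'k::{alg_closed_field, field_char_0}) set)
           (char_prob (integer_mod_group 2))"
proof -
  obtain e a where A: "A = {e, a}" "e \<noteq> a"
    and table: "\<And>x y z. \<lbrakk>x \<in> A; y \<in> A; z \<in> A\<rbrakk> \<Longrightarrow> p x y z = (if (z = e) = (x = y) then 1 else 0)"
    using two_element_pg_table[OF assms] by blast
  define s :: "'a \<Rightarrow> 'k" where "s x = (if x = e then 1 else -1)" for x
  have neq: "(1::'k) \<noteq> -1" "(-1::'k) \<noteq> 1" by simp_all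
  have "bij_betw (\<lambda>x. sign_char (s x)) A (irr_chars Z2)"
    using A neq by (auto simp: bij_betw_def inj_on_def irr_chars_Z2 s_def)
  moreover have "char_prob Z2 (sign_char (s x)) (sign_char (s y)) (sign_char (s z)) = p x y z"
    if "x \<in> A" "y \<in> A" "z \<in> A" for x y z
  proof -
    have "s z = s x * s y \<longleftrightarrow> (z = e) = (x = y)"
      using that A neq by (auto simp: s_def)
    then show ?thesis
      using table[OF that] char_prob_Z2[of "s x" "s y" "s z"] by (simp add: s_def)
  qed
  ultimately show ?thesis unfolding pg_isomorphic_def by blast
qed

end
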